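(* Let the asymmetric normal distribution with fixed $\mu$ and parameters $(p,\sigma)$ be written as an exponential family with natural parameter $\eta(\sigma,p)=\left(-\frac{1}{2\sigma^2\alpha^{-2}},\,-\frac{1}{2\sigma^2\alpha^2}\right)^T$ and $A(\sigma,p)=-\ln\beta$, where $\alpha=\sqrt{\frac{p}{1-p}}$ and $\beta=\frac{2\alpha}{\sigma(\alpha^2+1)}$. Then its conjugate prior probability density function, with hyperparameters $\nu$ and $\chi=(\chi_1,\chi_2)$, is given by $$f(p,\sigma;\nu,\chi)=Ig(\sigma^2\alpha^2;\nu_2,\chi_2')\,Ig(\sigma^2\alpha^{-2};\nu_2,\chi_1')\,B(p;\nu_1),$$ where $\nu_1=1+\nu/2$, $\nu_2=\nu/4-1$, $\chi_i'=\chi_i/2$ for $i=1,2$, $$Ig(\Sigma;a,b)=\frac{b^a}{\Gamma(a)}\Sigma^{-a-1}\exp\left(-\frac{b}{\Sigma}\right)$$ is the inverse gamma distribution, $\Gamma(\cdot)$ is the gamma function, $$B(p;a)=\frac{1}{B(a,a)}p^{a-1}(1-p)^{a-1}$$ is the symmetric beta distribution, and $B(\cdot,\cdot)$ (two arguments) is the beta function.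
   Context: For $p\in(0,1)$, $\sigma\in(0,\infty)$, $\mu\in\mathbb{R}$, with $\alpha=\sqrt{\frac{p}{1-p}}$ and $\beta=\frac{2\alpha}{\sigma(\alpha^2+1)}$, the asymmetric normal density is $$\psi(x;\mu,\sigma,p)=\begin{cases}\beta\,\Phi\left(\frac{x-\mu}{\sigma\alpha^{-1}}\right), & x\ge\mu,\\ \beta\,\Phi\left(\frac{x-\mu}{\sigma\alpha}\right), & x<\mu,\end{cases}$$ where $\Phi(\xi)=\frac{1}{\sqrt{2\pi}}\exp\left(-\frac12\xi^2\right)$. For fixed $\mu$ it equals $h(x)\exp(\eta(\sigma,p)^T T(x)-A(\sigma,p))$ with $h(x)=\frac{1}{\sqrt{2\pi}}$ and $T(x)=((x-\mu)^2\,\mathbb{I}[x\ge\mu],\,(x-\mu)^2\,\mathbb{I}[x<\mu])^T$, where $\mathbb{I}[\cdot]$ is the indicator function. The conjugate prior of an exponential family with natural parameter $\eta$ and function $A$ is the density of the form $C(\chi,\nu)\exp(\eta^T\chi-\nu A)$ with hyperparameters $\chi,\nu$ and a factor $C(\chi,\nu)$ depending only on them; here it is written directly as a function of $(p,\sigma)$.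
   Formalization: The displayed f has the conjugate form C exp(η^Tχ − νA) but does not integrate to 1 over (p,σ) in general; it is shown to be a probability density after division by a positive factor depending only on χ, ν. Hyperparameters are ν>4, χ_1, χ_2>0, so both Ig factors are proper. *)

theory Defs
  imports "HOL-Probability.Probability"
begin

definition alpha :: "real \<Rightarrow> real" where
  "alpha p = sqrt (p / (1 - p))"

definition beta :: "real \<Rightarrow> real \<Rightarrow> real" where
  "beta p \<sigma> = 2 * alpha p / (\<sigma> * ((alpha p)\<^sup>2 + 1))"

definition asym_normal_density :: "real \<Rightarrow> real \<times> real \<Rightarrow> real \<Rightarrow> real" where
  "asym_normal_density \<mu> = (\<lambda>(p, \<sigma>) x.
     if x \<ge> \<mu> then beta p \<sigma> * std_normal_density ((x - \<mu>) / (\<sigma> / alpha p))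
     else beta p \<sigma> * std_normal_density ((x - \<mu>) / (\<sigma> * alpha p)))"

definition param_space :: "(real \<times> real) set" where
  "param_space = {(p, \<sigma>). 0 < p \<and> p < 1 \<and> 0 < \<sigma>}"

definition an_eta :: "real \<times> real \<Rightarrow> real^2" where
  "an_eta = (\<lambda>(p, \<sigma>). vector [- (1 / (2 * (\<sigma>\<^sup>2 / (alpha p)\<^sup>2))),
                                - (1 / (2 * (\<sigma>\<^sup>2 * (alpha p)\<^sup>2)))])"

definition an_A :: "real \<times> real \<Rightarrow> real" where
  "an_A = (\<lambda>(p, \<sigma>). - ln (beta p \<sigma>))"

definition an_h :: "real \<Rightarrow> real" where
  "an_h x = 1 / sqrt (2 * pi)"

definition an_T :: "real \<Rightarrow> real \<Rightarrow> real^2" where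
  "an_T \<mu> x = vector [(x - \<mu>)\<^sup>2 * indicator {\<mu>..} x, (x - \<mu>)\<^sup>2 * indicator {..<\<mu>} x]"

definition exponential_family ::
  "'t set \<Rightarrow> ('t \<Rightarrow> 'x \<Rightarrow> real) \<Rightarrow> ('x \<Rightarrow> real) \<Rightarrow> ('t \<Rightarrow> 'e::real_inner) \<Rightarrow> ('x \<Rightarrow> 'e)
     \<Rightarrow> ('t \<Rightarrow> real) \<Rightarrow> bool" where
  "exponential_family \<Theta> d h \<eta> T A \<longleftrightarrow>
     (\<forall>\<theta>\<in>\<Theta>. \<forall>x. d \<theta> x = h x * exp (\<eta> \<theta> \<bullet> T x - A \<theta>))"

text \<open>The factor \<open>C\<close> depends on the hyperparameters only, never on \<open>\<theta>\<close>. The set \<open>H\<close> collects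
  the admissible hyperparameters \<open>(chi, \<nu>)\<close>.\<close>

definition conjugate_prior_form ::
  "'t set \<Rightarrow> ('t \<Rightarrow> 'e::real_inner) \<Rightarrow> ('t \<Rightarrow> real) \<Rightarrow> ('e \<times> real) set
     \<Rightarrow> ('e \<Rightarrow> real \<Rightarrow> 't \<Rightarrow> real) \<Rightarrow> bool" where
  "conjugate_prior_form \<Theta> \<eta> A H f \<longleftrightarrow>
     (\<exists>C. \<forall>(chi, \<nu>)\<in>H. C chi \<nu> > 0 \<and>
        (\<forall>\<theta>\<in>\<Theta>. f chi \<nu> \<theta> = C chi \<nu> * exp (\<eta> \<theta> \<bullet> chi - \<nu> * A \<theta>)))"

definition probability_density_on :: "'t::euclidean_space set \<Rightarrow> ('t \<Rightarrow> real) \<Rightarrow> bool" where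
  "probability_density_on \<Theta> f \<longleftrightarrow>
     set_borel_measurable lborel \<Theta> f \<and> (\<forall>\<theta>\<in>\<Theta>. f \<theta> \<ge> 0) \<and>
     prob_space (density lborel (\<lambda>\<theta>. ennreal (indicator \<Theta> \<theta> * f \<theta>)))"

definition conjugate_prior_density ::
  "'t::euclidean_space set \<Rightarrow> ('t \<Rightarrow> 'e::real_inner) \<Rightarrow> ('t \<Rightarrow> real) \<Rightarrow> ('e \<times> real) set
     \<Rightarrow> ('e \<Rightarrow> real \<Rightarrow> 't \<Rightarrow> real) \<Rightarrow> bool" where
  "conjugate_prior_density \<Theta> \<eta> A H f \<longleftrightarrow>
     conjugate_prior_form \<Theta> \<eta> A H f \<and> (\<forall>(chi, \<nu>)\<in>H. probability_density_on \<Theta> (f chi \<nu>))"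

definition inv_gamma_density :: "real \<Rightarrow> real \<Rightarrow> real \<Rightarrow> real" where
  "inv_gamma_density a b S = b powr a / Gamma a * S powr (- a - 1) * exp (- (b / S))"

definition sym_beta_density :: "real \<Rightarrow> real \<Rightarrow> real" where
  "sym_beta_density a p = 1 / Beta a a * p powr (a - 1) * (1 - p) powr (a - 1)"

text \<open>As a function of \<open>(p, \<sigma>)\<close> this has the form \<open>C * exp (\<eta> \<bullet> chi - \<nu> * A)\<close>, but its integral over
  \<open>param_space\<close> is not constantly 1: replacing \<open>chi\<close> by \<open>c\<^sup>2 * chi\<close> for \<open>c > 0\<close> divides that integral by
  \<open>c ^ 3\<close>. It is a probability density only after division by a factor depending on the
  hyperparameters.\<close>

definition an_prior :: "real^2 \<Rightarrow> real \<Rightarrow> real \<times> real \<Rightarrow> real" where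
  "an_prior chi \<nu> = (\<lambda>(p, \<sigma>).
     inv_gamma_density (\<nu> / 4 - 1) (chi $ 2 / 2) (\<sigma>\<^sup>2 * (alpha p)\<^sup>2) *
     inv_gamma_density (\<nu> / 4 - 1) (chi $ 1 / 2) (\<sigma>\<^sup>2 / (alpha p)\<^sup>2) *
     sym_beta_density (1 + \<nu> / 2) p)"

text \<open>Exactly the hyperparameters for which both inverse gamma factors are proper distributions,
  that is \<open>\<nu> / 4 - 1 > 0\<close> and \<open>chi $ i / 2 > 0\<close>; the beta factor is then proper as well.\<close>

definition hyper_space :: "((real^2) \<times> real) set" where
  "hyper_space = {(chi, \<nu>). \<nu> > 4 \<and> chi $ 1 > 0 \<and> chi $ 2 > 0}"

end

theory Submission
  imports Defs
begin

text \<open>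
  Since \<open>beta p \<sigma> = 2 * sqrt (p * (1 - p)) / \<sigma>\<close>, the factor \<open>exp (- \<nu> * A) = beta powr \<nu>\<close> splits into
  the powers of \<open>p\<close> and \<open>1 - p\<close> of the beta density and the power \<open>\<sigma> powr - \<nu>\<close>, which is what the two
  inverse gamma densities contribute because their arguments have product \<open>\<sigma> ^ 4\<close>.
  The kernel is integrable: \<open>beta p \<sigma> \<le> 1 / \<sigma>\<close> and \<open>alpha\<^sup>2 + 1 / alpha\<^sup>2 \<ge> 2\<close> bound it by
  \<open>\<sigma> powr - \<nu> * exp (- m / \<sigma>\<^sup>2)\<close> uniformly in \<open>p\<close>, where \<open>m\<close> is the smaller component of \<open>chi\<close>,
  and this is at most a multiple of \<open>1 / (1 + \<sigma>\<^sup>2)\<close>.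
\<close>

section \<open>Closed form of \<open>beta\<close> and the exponential family\<close>

lemma alpha_pos: "0 < p \<Longrightarrow> p < 1 \<Longrightarrow> alpha p > 0"
  by (simp add: alpha_def)

lemma alpha_squared: "0 < p \<Longrightarrow> p < 1 \<Longrightarrow> (alpha p)\<^sup>2 = p / (1 - p)"
  by (simp add: alpha_def)

lemma beta_pos: "0 < p \<Longrightarrow> p < 1 \<Longrightarrow> 0 < \<sigma> \<Longrightarrow> beta p \<sigma> > 0"
  using alpha_pos[of p] by (simp add: beta_def add_pos_pos)

lemma beta_eq:
  assumes "0 < p" "p < 1" "0 < \<sigma>"
  shows "beta p \<sigma> = 2 * sqrt (p * (1 - p)) / \<sigma>"
proof -
  have "(alpha p)\<^sup>2 + 1 = 1 / (1 - p)"
    using assms by (simp add: alpha_squared field_simps)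
  then have "beta p \<sigma> = 2 * (alpha p * (1 - p)) / \<sigma>"
    using assms by (simp add: beta_def)
  \<comment> \<open>Writing \<open>1 - p\<close> as the square of its root cancels the denominator
    of \<open>alpha p\<close>.\<close>
  moreover have "alpha p * (1 - p) = sqrt (p * (1 - p))"
    using assms real_sqrt_mult_self[of "1 - p"] unfolding alpha_def
    by (simp add: real_sqrt_divide real_sqrt_mult divide_eq_eq del: real_sqrt_mult_self)
  ultimately show ?thesis by simp
qed

lemma inner_vec2: "(x :: real^2) \<bullet> y = x $ 1 * y $ 1 + x $ 2 * y $ 2"
  by (simp add: inner_vec_def sum_2)

text \<open>At each \<open>x\<close> exactly one indicator in \<open>an_T\<close> is 1, which
  selects the quadratic term of the branch in force.\<close>

lemma exponential_family_asym_normal: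
  "exponential_family param_space (asym_normal_density \<mu>) an_h an_eta (an_T \<mu>) an_A"
  unfolding exponential_family_def
proof (intro ballI allI)
  fix \<theta> x assume "\<theta> \<in> param_space"
  then obtain p \<sigma> where \<theta>: "\<theta> = (p, \<sigma>)" and ps: "0 < p" "p < 1" "0 < \<sigma>"
    by (auto simp: param_space_def)
  show "asym_normal_density \<mu> \<theta> x = an_h x * exp (an_eta \<theta> \<bullet> an_T \<mu> x - an_A \<theta>)"
    using beta_pos[OF ps]
    by (simp add: \<theta> asym_normal_density_def an_h_def an_eta_def an_T_def an_A_def inner_vec2
        exp_add std_normal_density_def power_divide power_mult_distrib mult_ac)
qed

section \<open>The conjugate kernel and the product form of the prior\<close>

lemma conj_kernel_eq:
  assumes "0 < p" "p < 1" "0 < \<sigma>"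
  shows "exp (an_eta (p, \<sigma>) \<bullet> chi - \<nu> * an_A (p, \<sigma>)) =
    (beta p \<sigma>) powr \<nu> *
    (exp (- (chi $ 1 / 2 / (\<sigma>\<^sup>2 / (alpha p)\<^sup>2))) * exp (- (chi $ 2 / 2 / (\<sigma>\<^sup>2 * (alpha p)\<^sup>2))))"
proof -
  have "an_eta (p, \<sigma>) \<bullet> chi - \<nu> * an_A (p, \<sigma>) = \<nu> * ln (beta p \<sigma>) +
    (- (chi $ 1 / 2 / (\<sigma>\<^sup>2 / (alpha p)\<^sup>2)) + - (chi $ 2 / 2 / (\<sigma>\<^sup>2 * (alpha p)\<^sup>2)))"
    by (simp add: an_eta_def an_A_def inner_vec2)
  then show ?thesis
    using beta_pos[OF assms] by (simp only: exp_add) (simp add: powr_def)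
qed

lemma beta_powr:
  assumes "0 < p" "p < 1" "0 < \<sigma>"
  shows "(beta p \<sigma>) powr \<nu> =
    2 powr \<nu> * (p powr (\<nu> / 2) * (1 - p) powr (\<nu> / 2)) * \<sigma> powr - \<nu>"
proof -
  have "sqrt (p * (1 - p)) powr \<nu> = p powr (\<nu> / 2) * (1 - p) powr (\<nu> / 2)"
    using assms by (simp add: powr_half_sqrt[symmetric] powr_powr powr_mult)
  then show ?thesis
    using assms by (simp add: beta_eq powr_divide powr_mult powr_minus_divide)
qed

text \<open>An inverse gamma density of shape \<open>\<nu> / 4 - 1\<close> carries the exponent
  \<open>- (\<nu> / 4 - 1) - 1 = - (\<nu> / 4)\<close>; in the product of the two arguments
  \<open>alpha p\<close> cancels.\<close>

lemma scales_powr: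
  assumes "0 < p" "p < 1" "0 < \<sigma>"
  shows "(\<sigma>\<^sup>2 * (alpha p)\<^sup>2) powr (- (\<nu> / 4)) * (\<sigma>\<^sup>2 / (alpha p)\<^sup>2) powr (- (\<nu> / 4)) = \<sigma> powr - \<nu>"
proof -
  have "\<sigma>\<^sup>2 * (alpha p)\<^sup>2 * (\<sigma>\<^sup>2 / (alpha p)\<^sup>2) = \<sigma> powr 4"
    using assms alpha_pos[of p] by (simp add: field_simps powr_numeral)
  then show ?thesis
    using assms alpha_pos[of p] by (simp add: powr_mult[symmetric] powr_powr del: powr_numeral)
qed

text \<open>The normalising constants of the three densities, divided by \<open>2 powr \<nu>\<close>
  to compensate for the factor 2 in \<open>beta_eq\<close>.\<close>

definition an_const :: "real^2 \<Rightarrow> real \<Rightarrow> real" where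
  "an_const chi \<nu> = (chi $ 1 / 2) powr (\<nu> / 4 - 1) * (chi $ 2 / 2) powr (\<nu> / 4 - 1) /
     ((Gamma (\<nu> / 4 - 1))\<^sup>2 * Beta (1 + \<nu> / 2) (1 + \<nu> / 2) * 2 powr \<nu>)"

lemma an_const_pos: "(chi, \<nu>) \<in> hyper_space \<Longrightarrow> an_const chi \<nu> > 0"
  by (auto simp: an_const_def hyper_space_def Beta_def
      intro!: divide_pos_pos mult_pos_pos zero_less_power Gamma_real_pos)

lemma an_prior_eq:
  assumes "\<theta> \<in> param_space"
  shows "an_prior chi \<nu> \<theta> = an_const chi \<nu> * exp (an_eta \<theta> \<bullet> chi - \<nu> * an_A \<theta>)"
proof -
  obtain p \<sigma> where \<theta>: "\<theta> = (p, \<sigma>)" and ps: "0 < p" "p < 1" "0 < \<sigma>"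
    using assms by (auto simp: param_space_def)
  show ?thesis
    \<comment> \<open>Reading \<open>scales_powr\<close> from right to left splits
      \<open>\<sigma> powr - \<nu>\<close> into the powers found in the two inverse gamma
      densities.\<close>
    unfolding \<theta> conj_kernel_eq[OF ps] beta_powr[OF ps] scales_powr[OF ps, symmetric]
    by (simp add: an_prior_def an_const_def inv_gamma_density_def sym_beta_density_def
        power2_eq_square mult_ac)
qed

lemma conjugate_prior_form_an_prior:
  "conjugate_prior_form param_space an_eta an_A hyper_space an_prior"
  unfolding conjugate_prior_form_def
  by (rule exI[of _ an_const]) (auto simp: an_const_pos an_prior_eq)

text \<open>\<open>Z\<close> depends on the hyperparameters only, so it is absorbed into the factor
  \<open>C\<close>.\<close>

lemma conjugate_prior_form_divide:
  assumes "conjugate_prior_form \<Theta> \<eta> A H f" "\<forall>(chi, \<nu>)\<in>H. Z chi \<nu> > 0"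
  shows "conjugate_prior_form \<Theta> \<eta> A H (\<lambda>chi \<nu> \<theta>. f chi \<nu> \<theta> / Z chi \<nu>)"
proof -
  obtain C where "\<forall>(chi, \<nu>)\<in>H. C chi \<nu> > 0 \<and>
        (\<forall>\<theta>\<in>\<Theta>. f chi \<nu> \<theta> = C chi \<nu> * exp (\<eta> \<theta> \<bullet> chi - \<nu> * A \<theta>))"
    using assms(1) unfolding conjugate_prior_form_def by blast
  with assms(2) show ?thesis
    unfolding conjugate_prior_form_def
    by (intro exI[of _ "\<lambda>chi \<nu>. C chi \<nu> / Z chi \<nu>"]) fastforce
qed

section \<open>Normalising a positive integrable function on an open set\<close>

text \<open>If the integral of a positive function vanished, \<Theta> would be a null set, which a
  nonempty open set is not.\<close>

lemma probability_density_on_normalise: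
  fixes f :: "'a::euclidean_space \<Rightarrow> real"
  assumes int: "set_integrable lborel \<Theta> f" and pos: "\<And>\<theta>. \<theta> \<in> \<Theta> \<Longrightarrow> f \<theta> > 0"
    and \<Theta>: "open \<Theta>" "\<Theta> \<noteq> {}"
  defines "Z \<equiv> (LINT \<theta>:\<Theta>|lborel. f \<theta>)"
  shows "Z > 0" and "probability_density_on \<Theta> (\<lambda>\<theta>. f \<theta> / Z)"
proof -
  let ?g = "\<lambda>\<theta>. indicator \<Theta> \<theta> * f \<theta>"
  have int': "integrable lborel ?g"
    using int by (simp add: set_integrable_def)
  have nonneg: "?g \<theta> \<ge> 0" for \<theta>
    using pos[of \<theta>] by (simp add: indicator_def less_imp_le)
  have Z: "Z = (\<integral>\<theta>. ?g \<theta> \<partial>lborel)"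
    by (simp add: Z_def set_lebesgue_integral_def)
  have "Z \<noteq> 0"
  proof
    assume "Z = 0"
    then have "AE \<theta> in lborel. ?g \<theta> = 0"
      using integral_nonneg_eq_0_iff_AE[OF int'] nonneg Z by auto
    then have "AE \<theta> in lborel. \<theta> \<notin> \<Theta>"
      by eventually_elim (use pos in \<open>fastforce simp: indicator_def\<close>)
    \<comment> \<open>Negligible sets are the null sets of the completed measure, hence the passage
      from \<open>lborel\<close> to \<open>lebesgue\<close>.\<close>
    then have "AE \<theta> in lebesgue. \<theta> \<notin> \<Theta>"
      by (rule AE_completion)
    moreover have "\<Theta> \<in> sets lebesgue"
      using \<Theta>(1) by simp
    ultimately have "negligible \<Theta>"
      by (simp add: negligible_iff_null_sets AE_iff_null_sets)
    then show False
      using open_not_negligible \<Theta> by blast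
  qed
  moreover have "Z \<ge> 0"
    unfolding Z using nonneg by (rule Bochner_Integration.integral_nonneg)
  ultimately show "Z > 0" by simp
  have "(\<integral>\<^sup>+ \<theta>. ennreal (indicator \<Theta> \<theta> * (f \<theta> / Z)) \<partial>lborel) = (\<integral>\<theta>. ?g \<theta> / Z \<partial>lborel)"
    using nonneg \<open>Z > 0\<close> int' by (subst nn_integral_eq_integral[symmetric]) auto
  also have "\<dots> = 1"
    using \<open>Z > 0\<close> Z by simp
  finally have one: "(\<integral>\<^sup>+ \<theta>. ennreal (indicator \<Theta> \<theta> * (f \<theta> / Z)) \<partial>lborel) = 1" .
  have meas: "(\<lambda>\<theta>. indicator \<Theta> \<theta> * (f \<theta> / Z)) \<in> borel_measurable lborel"
    using borel_measurable_integrable[OF int'] by (simp add: borel_measurable_divide)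
  show "probability_density_on \<Theta> (\<lambda>\<theta>. f \<theta> / Z)"
    unfolding probability_density_on_def set_borel_measurable_def
    using meas one pos \<open>Z > 0\<close>
    by (auto intro!: prob_spaceI simp: emeasure_density less_imp_le)
qed

section \<open>A bound for the kernel, uniform in \<open>p\<close>\<close>

text \<open>The maximum over \<open>s\<close> is \<open>(c / m) powr c * exp (- c)\<close>, attained
  at \<open>s = c / m\<close>. The inequality ln x \<le> x - 1 at \<open>x = m * s / c\<close>
  yields it, and the factor \<open>exp (- c)\<close> is dropped.\<close>

lemma powr_mult_exp_le:
  fixes s c m :: real
  assumes "s > 0" "c > 0" "m > 0"
  shows "s powr c * exp (- (m * s)) \<le> (c / m) powr c"
proof -
  have "ln (m * s / c) \<le> m * s / c - 1"
    using assms by (intro ln_le_minus_one) simp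
  then have "c * ln (m * s / c) \<le> m * s"
    using assms by (simp add: field_simps)
  then have "c * ln s - m * s \<le> c * ln (c / m)"
    using assms by (simp add: ln_mult ln_div algebra_simps)
  then have "exp (c * ln s - m * s) \<le> exp (c * ln (c / m))" by simp
  then show ?thesis
    using assms by (simp add: powr_def exp_diff exp_minus field_simps)
qed

text \<open>In terms of \<open>s = 1 / \<sigma>\<^sup>2\<close> the kernel is at most
  \<open>s powr c * exp (- (m * s))\<close>. Multiplied by
  \<open>1 + \<sigma>\<^sup>2 = 1 + 1 / s\<close>, this becomes two terms covered by
  \<open>powr_mult_exp_le\<close>, with exponents \<open>c\<close> and \<open>c - 1\<close>; the
  latter is positive because \<open>\<nu> > 2\<close>.\<close>

lemma kernel_le:
  assumes "0 < p" "p < 1" "0 < \<sigma>" "\<nu> > 2" "m > 0" "m \<le> chi $ 1" "m \<le> chi $ 2"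
  defines "c \<equiv> \<nu> / 2"
  shows "exp (an_eta (p, \<sigma>) \<bullet> chi - \<nu> * an_A (p, \<sigma>)) \<le>
    ((c / m) powr c + ((c - 1) / m) powr (c - 1)) / (1 + \<sigma>\<^sup>2)"
proof -
  define s where "s = 1 / \<sigma>\<^sup>2"
  define a where "a = (alpha p)\<^sup>2"
  have a: "a > 0" using assms alpha_pos[of p] by (simp add: a_def)
  have s: "s > 0" using assms by (simp add: s_def)
  have "sqrt (p * (1 - p)) \<le> (p + (1 - p)) / 2"
    using assms by (intro arith_geo_mean_sqrt) auto
  then have "beta p \<sigma> \<le> 1 / \<sigma>"
    using assms by (simp add: beta_eq divide_simps)
  then have "(beta p \<sigma>) powr \<nu> \<le> (1 / \<sigma>) powr \<nu>"
    using beta_pos[of p \<sigma>] assms by (intro powr_mono2) auto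
  also have "1 / \<sigma> = s powr (1/2)"
    using assms by (simp add: s_def powr_half_sqrt real_sqrt_divide)
  finally have 1: "(beta p \<sigma>) powr \<nu> \<le> s powr c"
    by (simp add: powr_powr c_def)
  \<comment> \<open>This is \<open>(a - 1)\<^sup>2 \<ge> 0\<close> divided by \<open>a\<close>; it
    makes the decay rate in \<open>s\<close> independent of \<open>p\<close>.\<close>
  have "2 \<le> a + 1 / a"
    using a sum_squares_ge_zero[of "a - 1" 0] by (simp add: field_simps power2_eq_square)
  then have "m * 2 \<le> m * (a + 1 / a)"
    using assms by (intro mult_left_mono) auto
  also have "\<dots> \<le> chi $ 1 * a + chi $ 2 * (1 / a)"
    using a assms unfolding distrib_left by (intro add_mono mult_right_mono) auto
  finally have "m * s \<le> (chi $ 1 * a + chi $ 2 * (1 / a)) / 2 * s"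
    using s by (intro mult_right_mono) auto
  also have "\<dots> = chi $ 1 / 2 / (\<sigma>\<^sup>2 / a) + chi $ 2 / 2 / (\<sigma>\<^sup>2 * a)"
    by (simp add: s_def add_divide_distrib)
  finally have 2: "exp (- (chi $ 1 / 2 / (\<sigma>\<^sup>2 / a))) * exp (- (chi $ 2 / 2 / (\<sigma>\<^sup>2 * a))) \<le> exp (- (m * s))"
    by (simp add: exp_add[symmetric])
  have "exp (an_eta (p, \<sigma>) \<bullet> chi - \<nu> * an_A (p, \<sigma>)) \<le> s powr c * exp (- (m * s))"
    unfolding conj_kernel_eq[OF assms(1-3)] using 1 2 by (intro mult_mono) (auto simp: a_def)
  \<comment> \<open>An auxiliary identity rather than a link of the chain: division by
    \<open>1 + \<sigma>\<^sup>2\<close> turns it into the next link.\<close>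
  also have "\<dots> * (1 + \<sigma>\<^sup>2) = s powr c * exp (- (m * s)) + s powr (c - 1) * exp (- (m * s))"
  proof -
    have "s powr (c - 1) = s powr c * \<sigma>\<^sup>2"
      using assms s by (simp add: powr_diff s_def)
    then show ?thesis by (simp add: algebra_simps)
  qed
  then have "s powr c * exp (- (m * s)) = 
      (s powr c * exp (- (m * s)) + s powr (c - 1) * exp (- (m * s))) / (1 + \<sigma>\<^sup>2)"
    by (subst eq_divide_eq) (auto simp: add_nonneg_eq_0_iff)
  also have "\<dots> \<le> ((c / m) powr c + ((c - 1) / m) powr (c - 1)) / (1 + \<sigma>\<^sup>2)"
    using s assms by (intro divide_right_mono add_mono powr_mult_exp_le) auto
  finally show ?thesis .
qed

section \<open>Integrability of the prior over the parameter space\<close>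

lemma open_param_space: "open param_space"
proof -
  have "param_space = {0<..<1} \<times> {0<..}" by (auto simp: param_space_def)
  then show ?thesis by (metis open_Times open_greaterThan open_greaterThanLessThan)
qed

text \<open>By Fubini: the inner integral of the absolute value is a constant multiple of
  \<open>\<bar>f x\<bar>\<close>.\<close>

lemma (in pair_sigma_finite) integrable_mult_pair:
  fixes f :: "'a \<Rightarrow> real" and g :: "'b \<Rightarrow> real"
  assumes f: "integrable M1 f" and g: "integrable M2 g"
  shows "integrable (M1 \<Otimes>\<^sub>M M2) (\<lambda>(x, y). f x * g y)"
proof -
  note [measurable] = borel_measurable_integrable[OF f] borel_measurable_integrable[OF g]
  show ?thesis
  proof (rule Fubini_integrable)
    show "integrable M1 (\<lambda>x. \<integral>y. norm (case (x, y) of (x, y) \<Rightarrow> f x * g y) \<partial>M2)"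
      using f by (simp add: abs_mult)
  qed (use g in simp_all)
qed

text \<open>The bound is constant in \<open>p\<close>, which ranges over an interval of finite
  length, and integrable in \<sigma> over the whole line.\<close>

lemma set_integrable_param_space_bound:
  "set_integrable lborel param_space (\<lambda>(p, \<sigma>). K / (1 + \<sigma>\<^sup>2))"
proof -
  have "set_integrable lborel UNIV (\<lambda>x. inverse (1 + x^2) :: real)"
    using integrable_inverse_1_plus_square by (simp add: einterval_def)
  then have "integrable lborel (\<lambda>x. K * inverse (1 + x^2) :: real)"
    by (simp add: set_integrable_def)
  moreover have "integrable lborel (indicator {0<..<1} :: real \<Rightarrow> real)"
    by simp
  ultimately have "integrable lborel (\<lambda>(p, \<sigma>). indicator {0<..<1::real} p * (K * inverse (1 + \<sigma>\<^sup>2)))"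
    using lborel_pair.integrable_mult_pair unfolding lborel_prod by blast
  \<comment> \<open>The product already carries the condition on \<open>p\<close>; the restriction
    adds \<open>0 < \<sigma>\<close>.\<close>
  from integrable_mult_indicator[OF _ this, of param_space]
  have "integrable lborel (\<lambda>\<theta>. indicator param_space \<theta> *\<^sub>R
      (case \<theta> of (p, \<sigma>) \<Rightarrow> indicator {0<..<1::real} p * (K * inverse (1 + \<sigma>\<^sup>2))))"
    using open_param_space by simp
  then show ?thesis
    unfolding set_integrable_def
    by (rule back_subst[of "integrable lborel"])
      (auto simp: fun_eq_iff param_space_def indicator_def divide_inverse)
qed

lemma borel_measurable_an_prior: "an_prior chi \<nu> \<in> borel_measurable borel"
proof -
  have "an_prior chi \<nu> \<in> borel_measurable (borel \<Otimes>\<^sub>M borel)"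
    unfolding an_prior_def inv_gamma_density_def sym_beta_density_def alpha_def
    by measurable
  then show ?thesis by (simp only: borel_prod)
qed

lemma set_integrable_an_prior:
  assumes "(chi, \<nu>) \<in> hyper_space"
  shows "set_integrable lborel param_space (an_prior chi \<nu>)"
proof -
  define m where "m = min (chi $ 1) (chi $ 2)"
  \<comment> \<open>The numerator of the bound in \<open>kernel_le\<close>, times the constant
    relating the kernel to \<open>an_prior\<close>.\<close>
  define K where "K = an_const chi \<nu> * ((\<nu> / 2 / m) powr (\<nu> / 2) + ((\<nu> / 2 - 1) / m) powr (\<nu> / 2 - 1))"
  have \<nu>: "\<nu> > 4" and m: "m > 0" "m \<le> chi $ 1" "m \<le> chi $ 2"
    using assms by (auto simp: hyper_space_def m_def)
  note C = an_const_pos[OF assms]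
  note borel_measurable_an_prior[measurable]
  have [measurable]: "param_space \<in> sets borel"
    using open_param_space by simp
  have meas: "set_borel_measurable lborel param_space (an_prior chi \<nu>)"
    unfolding set_borel_measurable_def by measurable
  show ?thesis
  proof (rule set_integrable_bound[OF set_integrable_param_space_bound[of K] meas])
    show "AE \<theta> in lborel. \<theta> \<in> param_space \<longrightarrow>
      norm (an_prior chi \<nu> \<theta>) \<le> norm (case \<theta> of (p, \<sigma>) \<Rightarrow> K / (1 + \<sigma>\<^sup>2))"
    proof (intro AE_I2 impI)
      fix \<theta> assume \<theta>: "\<theta> \<in> param_space"
      obtain p \<sigma> where ps: "\<theta> = (p, \<sigma>)" "0 < p" "p < 1" "0 < \<sigma>"
        using \<theta> by (auto simp: param_space_def)
      have "an_prior chi \<nu> \<theta> \<le> K / (1 + \<sigma>\<^sup>2)"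
        using C mult_left_mono[OF kernel_le[OF ps(2-4) _ m, of \<nu>], of "an_const chi \<nu>"] \<nu>
        unfolding an_prior_eq[OF \<theta>] by (simp add: K_def ps)
      moreover have "an_prior chi \<nu> \<theta> \<ge> 0"
        using C by (simp add: an_prior_eq[OF \<theta>])
      ultimately show "norm (an_prior chi \<nu> \<theta>) \<le> norm (case \<theta> of (p, \<sigma>) \<Rightarrow> K / (1 + \<sigma>\<^sup>2))"
        unfolding ps(1) prod.case real_norm_def by linarith
    qed
  qed
qed

section \<open>The normalised conjugate prior\<close>

theorem theorem11:
  fixes \<mu> :: real
  shows "exponential_family param_space (asym_normal_density \<mu>) an_h an_eta (an_T \<mu>) an_A
    \<and> conjugate_prior_form param_space an_eta an_A hyper_space an_prior
    \<and> (\<exists>Z. (\<forall>(chi, \<nu>)\<in>hyper_space. Z chi \<nu> > 0) \<and>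
         conjugate_prior_density param_space an_eta an_A hyper_space
           (\<lambda>chi \<nu> \<theta>. an_prior chi \<nu> \<theta> / Z chi \<nu>))"
proof -
  \<comment> \<open>The total mass of \<open>an_prior\<close> is the witness; it is a function of
    the hyperparameters alone.\<close>
  define Z where "Z chi \<nu> = (LINT \<theta>:param_space|lborel. an_prior chi \<nu> \<theta>)" for chi \<nu>
  have ne: "param_space \<noteq> {}"
  proof -
    have "(1 / 2, 1) \<in> param_space" by (simp add: param_space_def)
    then show ?thesis by blast
  qed
  have norm: "Z chi \<nu> > 0"
    "probability_density_on param_space (\<lambda>\<theta>. an_prior chi \<nu> \<theta> / Z chi \<nu>)"
    if "(chi, \<nu>) \<in> hyper_space" for chi \<nu>
  proof -
    have "an_prior chi \<nu> \<theta> > 0" if "\<theta> \<in> param_space" for \<theta>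
      using an_prior_eq[OF that] an_const_pos[OF \<open>(chi, \<nu>) \<in> hyper_space\<close>] by simp
    from probability_density_on_normalise[OF set_integrable_an_prior[OF that] this open_param_space ne]
    show "Z chi \<nu> > 0" "probability_density_on param_space (\<lambda>\<theta>. an_prior chi \<nu> \<theta> / Z chi \<nu>)"
      unfolding Z_def by auto
  qed
  then have pos: "\<forall>(chi, \<nu>)\<in>hyper_space. Z chi \<nu> > 0" by auto
  have "conjugate_prior_density param_space an_eta an_A hyper_space
           (\<lambda>chi \<nu> \<theta>. an_prior chi \<nu> \<theta> / Z chi \<nu>)"
    unfolding conjugate_prior_density_def
    using conjugate_prior_form_divide[OF conjugate_prior_form_an_prior pos] norm(2) by auto
  with pos show ?thesis
    using exponential_family_asym_normal conjugate_prior_form_an_prior by blast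
qed

end
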